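(* Let $m\in\mathbb{N}_0$, let $\mathsf{B}_1,\mathsf{B}_2$ be boundary operators of the form $\mathsf{B}_i=\sum_{j=0}^3\mathrm{op}[b_j^{(i)}]\mathrm{Tr}_j$, $i\in\{1,2\}$, where the $b_j^{(i)}$ are smooth symbols on $(\mathbb{R}\setminus\{0\})\times\mathbb{R}^{n-1}$, and consider the associated extended boundary matrix $\mathcal{B}:=\mathcal{B}^{(m)}:(\mathbb{R}\setminus\{0\})\times\mathbb{R}^{n-1}\to\mathbb{C}^{(4+m)\times(4+m)}$. Then $\mathsf{B}_1$ and $\mathsf{B}_2$ verify the Lopatinskiĭ-Shapiro conditions for $D$ if and only if $\det\mathcal{B}(\tau,\xi')\neq0$ for all $(\tau,\xi')\in(\mathbb{R}\setminus\{0\})\times\mathbb{R}^{n-1}$.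
   Context: Let $T>0$, $n\in\mathbb{N}$ and $D(\tau,\xi)=\mathrm{i}\tau+|\xi|^2(\mathrm{i}\tau+|\xi|^2)$ for $(\tau,\xi)\in\mathbb{R}\times\mathbb{R}^n$, with $\xi=(\xi',\xi_n)$. For $\tau\neq0$ and $\xi'\in\mathbb{R}^{n-1}$, the polynomial $z\mapsto D(\tau,\xi',z)$ has exactly two roots $\rho_1^+(\tau,\xi'),\rho_2^+(\tau,\xi')$ with positive imaginary part (and two with negative imaginary part). Set \[D^+(\tau,\xi',z):=(z-\rho_1^+(\tau,\xi'))(z-\rho_2^+(\tau,\xi'))=d_2^+(\tau,\xi')(\mathrm{i}z)^2+d_1^+(\tau,\xi')(\mathrm{i}z)+d_0^+(\tau,\xi'),\] so $d_2^+=-1$, $d_1^+=\mathrm{i}(\rho_1^++\rho_2^+)$, $d_0^+=\rho_1^+\rho_2^+$. $\mathrm{Tr}_j\phi=\partial_n^j\phi|_{x_n=0}$, and $\mathrm{op}[b]$ denotes the Fourier multiplier operator with symbol $b$ in the variables $(t,x')\in\mathbb{R}/T\mathbb{Z}\times\mathbb{R}^{n-1}$. Extended boundary matrix: for $m\in\mathbb{N}_0$, the extended boundary matrix associated to $D$ and $(\mathsf{B}_1,\mathsf{B}_2)$ is the $(4+m)\times(4+m)$ matrix symbol $\mathcal{B}^{(m)}$ with entries, for $j\in\{1,\ldots,4+m\}$, \[ \mathcal{B}^{(m)}_{ij}:=\begin{cases} b^{(i)}_{j-1}, & i\in\{1,2\},\\ d^+_{j+2-i}, & i\in\{3,\ldots,4+m\},\end{cases}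 \] where $d_k^+=0$ if $k<0$ or $k>2$, and $b_k^{(i)}=0$ if $k>3$. Lopatinskiĭ-Shapiro conditions: $(\mathsf{B}_1,\mathsf{B}_2)$ verifies them for $D$ if for every fixed $(\tau,\xi')\in(\mathbb{R}\setminus\{0\})\times\mathbb{R}^{n-1}$ the polynomials $z\mapsto B_i(\tau,\xi',z):=\sum_{j=0}^3b_j^{(i)}(\tau,\xi')(\mathrm{i}z)^j$, $i=1,2$, are linearly independent modulo $z\mapsto D^+(\tau,\xi',z)$, i.e. no nontrivial linear combination over $\mathbb{C}$ of $B_1(\tau,\xi',\cdot)$ and $B_2(\tau,\xi',\cdot)$ is divisible by $D^+(\tau,\xi',\cdot)$ in $\mathbb{C}[z]$. *)

theory Defs
  imports "HOL-Analysis.Analysis" "Jordan_Normal_Form.Determinant"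
begin

text \<open>
  A symbol is a function of \<open>\<tau>\<close> and \<open>\<xi>'\<close>. The tangential variable \<open>\<xi>'\<close> ranges over
  \<^term>\<open>topspace (Euclidean_space (n - 1))\<close>, the real sequences vanishing from index \<open>n - 1\<close> on.
  This carrier covers \<open>n = 1\<close>, where it is a single point; a type \<open>real ^ 'k\<close> would not.
  Values of a symbol outside \<open>symbol_domain n\<close> are irrelevant.
\<close>

type_synonym symbol = "real \<Rightarrow> (nat \<Rightarrow> real) \<Rightarrow> complex"

definition symbol_domain :: "nat \<Rightarrow> (real \<times> (nat \<Rightarrow> real)) set" where
  "symbol_domain n = (UNIV - {0}) \<times> topspace (Euclidean_space (n - 1))"

text \<open>
  \<open>Ck_symbol n k f\<close>: all partial derivatives of \<open>f\<close> of order at most \<open>k\<close> exist and are continuous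
  on \<open>symbol_domain n\<close>. The product topology on \<^typ>\<open>nat \<Rightarrow> real\<close> induces the Euclidean one on
  \<^term>\<open>topspace (Euclidean_space (n - 1))\<close>.
\<close>

primrec Ck_symbol :: "nat \<Rightarrow> nat \<Rightarrow> symbol \<Rightarrow> bool" where
  "Ck_symbol n 0 f \<longleftrightarrow> continuous_on (symbol_domain n) (\<lambda>(\<tau>, \<xi>). f \<tau> \<xi>)"
| "Ck_symbol n (Suc k) f \<longleftrightarrow>
     (\<exists>g. (\<forall>(\<tau>, \<xi>) \<in> symbol_domain n.
              ((\<lambda>s. f s \<xi>) has_vector_derivative g \<tau> \<xi>) (at \<tau>))
          \<and> Ck_symbol n k g) \<and>
     (\<forall>l < n - 1. \<exists>g. (\<forall>(\<tau>, \<xi>) \<in> symbol_domain n.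
              ((\<lambda>s. f \<tau> (\<xi>(l := s))) has_vector_derivative g \<tau> \<xi>) (at (\<xi> l)))
          \<and> Ck_symbol n k g)"

definition smooth_symbol :: "nat \<Rightarrow> symbol \<Rightarrow> bool" where
  "smooth_symbol n f \<longleftrightarrow> (\<forall>k. Ck_symbol n k f)"

definition norm_sq :: "nat \<Rightarrow> (nat \<Rightarrow> real) \<Rightarrow> real" where
  "norm_sq k x = (\<Sum>i<k. (x i)\<^sup>2)"

definition D_symbol :: "nat \<Rightarrow> symbol" where
  "D_symbol n \<tau> \<xi> = \<i> * \<tau> + norm_sq n \<xi> * (\<i> * \<tau> + norm_sq n \<xi>)"

text \<open>
  The polynomial \<open>z \<mapsto> D (\<tau>, \<xi>', z)\<close>, that is, \<open>D_symbol n \<tau>\<close> with \<open>|\<xi>|\<^sup>2\<close> replaced by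
  \<open>|\<xi>'|\<^sup>2 + z\<^sup>2\<close>; see \<open>poly_D_poly_of_real\<close>.
\<close>

definition D_poly :: "nat \<Rightarrow> real \<Rightarrow> (nat \<Rightarrow> real) \<Rightarrow> complex poly" where
  "D_poly n \<tau> \<xi> =
     (let q = [:of_real (norm_sq (n - 1) \<xi>), 0, 1:] in [:\<i> * \<tau>:] + q * ([:\<i> * \<tau>:] + q))"

definition D_plus_roots :: "nat \<Rightarrow> real \<Rightarrow> (nat \<Rightarrow> real) \<Rightarrow> complex set" where
  "D_plus_roots n \<tau> \<xi> = {\<rho>. poly (D_poly n \<tau> \<xi>) \<rho> = 0 \<and> Im \<rho> > 0}"

text \<open>
  For \<open>\<tau> \<noteq> 0\<close> there are exactly two roots in the upper half plane, and they are simple;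
  see \<open>D_plus_roots_two\<close>, \<open>D_poly_eq_prod\<close> and \<open>D_plus_eq\<close>.
\<close>

definition D_plus :: "nat \<Rightarrow> real \<Rightarrow> (nat \<Rightarrow> real) \<Rightarrow> complex poly" where
  "D_plus n \<tau> \<xi> = (\<Prod>\<rho>\<in>D_plus_roots n \<tau> \<xi>. [:- \<rho>, 1:])"

text \<open>Coefficients of \<open>D_plus\<close> with respect to the powers of \<open>\<i> z\<close>, rather than of \<open>z\<close>.\<close>

definition d_plus :: "nat \<Rightarrow> int \<Rightarrow> symbol" where
  "d_plus n k \<tau> \<xi> =
     (if 0 \<le> k \<and> k \<le> 2 then coeff (D_plus n \<tau> \<xi>) (nat k) / \<i> ^ nat k else 0)"

text \<open>
  A boundary operator \<open>\<Sum>j\<le>3. op[b j] Tr\<^sub>j\<close> is given by its symbols \<open>b 0, \<dots>, b 3\<close>; the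
  values \<open>b j\<close> for \<open>j > 3\<close> are ignored. It cannot be replaced by the operator it induces on
  functions of \<open>(t, x')\<close>: by periodicity in \<open>t\<close>, that operator only sees \<open>b j\<close> at the frequencies
  \<open>\<tau> \<in> (2\<pi>/T)\<int>\<close>, whereas the conditions below involve all \<open>\<tau> \<noteq> 0\<close>.
\<close>

type_synonym boundary_operator = "nat \<Rightarrow> symbol"

definition smooth_boundary_operator :: "nat \<Rightarrow> boundary_operator \<Rightarrow> bool" where
  "smooth_boundary_operator n b \<longleftrightarrow> (\<forall>j\<le>3. smooth_symbol n (b j))"

definition boundary_poly :: "boundary_operator \<Rightarrow> real \<Rightarrow> (nat \<Rightarrow> real) \<Rightarrow> complex poly" where
  "boundary_poly b \<tau> \<xi> = (\<Sum>j\<le>3. monom (b j \<tau> \<xi> * \<i> ^ j) j)"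

definition lopatinskii_shapiro ::
  "nat \<Rightarrow> boundary_operator \<Rightarrow> boundary_operator \<Rightarrow> bool" where
  "lopatinskii_shapiro n b1 b2 \<longleftrightarrow>
     (\<forall>(\<tau>, \<xi>) \<in> symbol_domain n. \<forall>c1 c2 :: complex.
        D_plus n \<tau> \<xi> dvd Polynomial.smult c1 (boundary_poly b1 \<tau> \<xi>) + Polynomial.smult c2 (boundary_poly b2 \<tau> \<xi>)
        \<longrightarrow> c1 = 0 \<and> c2 = 0)"

definition boundary_coeff :: "boundary_operator \<Rightarrow> nat \<Rightarrow> symbol" where
  "boundary_coeff b k \<tau> \<xi> = (if k \<le> 3 then b k \<tau> \<xi> else 0)"

text \<open>The entries use row and column indices starting from 1; matrices are indexed from 0.\<close>

definition extended_boundary_entry ::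
  "nat \<Rightarrow> boundary_operator \<Rightarrow> boundary_operator \<Rightarrow> nat \<Rightarrow> nat \<Rightarrow> symbol" where
  "extended_boundary_entry n b1 b2 i j \<tau> \<xi> =
     (if i = 1 then boundary_coeff b1 (j - 1) \<tau> \<xi>
      else if i = 2 then boundary_coeff b2 (j - 1) \<tau> \<xi>
      else d_plus n (int j + 2 - int i) \<tau> \<xi>)"

definition extended_boundary_matrix ::
  "nat \<Rightarrow> nat \<Rightarrow> boundary_operator \<Rightarrow> boundary_operator \<Rightarrow>
     real \<Rightarrow> (nat \<Rightarrow> real) \<Rightarrow> complex Matrix.mat" where
  "extended_boundary_matrix n m b1 b2 \<tau> \<xi> =
     Matrix.mat (4 + m) (4 + m) (\<lambda>(i, j). extended_boundary_entry n b1 b2 (i + 1) (j + 1) \<tau> \<xi>)"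

lemma poly_D_poly:
  fixes z :: complex
  shows "poly (D_poly n \<tau> \<xi>) z =
     \<i> * \<tau> + (norm_sq (n - 1) \<xi> + z\<^sup>2) * (\<i> * \<tau> + (norm_sq (n - 1) \<xi> + z\<^sup>2))"
  by (simp add: D_poly_def Let_def power2_eq_square algebra_simps)

lemma poly_D_poly_of_real:
  assumes "n \<ge> 1"
  shows "poly (D_poly n \<tau> \<xi>) (of_real x) = D_symbol n \<tau> (\<xi>(n - 1 := x))"
proof -
  obtain k where n: "n = Suc k" using assms by (cases n) auto
  have "norm_sq n (\<xi>(n - 1 := x)) = norm_sq (n - 1) \<xi> + x\<^sup>2"
    by (simp add: n norm_sq_def)
  then show ?thesis by (simp add: poly_D_poly D_symbol_def)
qed

lemma poly_boundary_poly:
  fixes z :: complex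
  shows "poly (boundary_poly b \<tau> \<xi>) z = (\<Sum>j\<le>3. b j \<tau> \<xi> * (\<i> * z) ^ j)"
  by (simp add: boundary_poly_def poly_sum poly_monom power_mult_distrib mult.assoc)

lemma upper_sqrt:
  fixes u :: complex
  assumes "\<And>r. r \<ge> 0 \<Longrightarrow> u \<noteq> of_real r"
  obtains \<rho> where "Im \<rho> > 0" "\<rho>\<^sup>2 = u" "\<And>z :: complex. z\<^sup>2 = u \<Longrightarrow> Im z > 0 \<Longrightarrow> z = \<rho>"
proof -
  have nz: "Im (csqrt u) \<noteq> 0"
  proof
    assume "Im (csqrt u) = 0"
    then have "csqrt u = of_real (Re (csqrt u))" by (simp add: complex_eq_iff)
    then have "u = of_real ((Re (csqrt u))\<^sup>2)" by (metis of_real_power power2_csqrt)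
    then show False using assms[of "(Re (csqrt u))\<^sup>2"] by simp
  qed
  define \<rho> where "\<rho> = (if Im (csqrt u) > 0 then csqrt u else - csqrt u)"
  have 1: "Im \<rho> > 0" using nz by (auto simp: \<rho>_def simp del: csqrt.simps)
  have 2: "\<rho>\<^sup>2 = u" by (simp add: \<rho>_def del: csqrt.simps)
  have "z = \<rho>" if "z\<^sup>2 = u" "Im z > 0" for z :: complex
  proof -
    have "z = \<rho> \<or> z = - \<rho>" using that(1) 2 by (metis power2_eq_iff)
    then show ?thesis using that(2) 1 by auto
  qed
  with 1 2 show ?thesis by (rule that)
qed

lemma D_plus_roots_aux:
  fixes \<tau> :: real
  assumes "\<tau> \<noteq> 0"
  obtains \<rho>1 \<rho>2 where "\<rho>1 \<noteq> \<rho>2" "D_plus_roots n \<tau> \<xi> = {\<rho>1, \<rho>2}"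
    "\<And>z :: complex. poly (D_poly n \<tau> \<xi>) z = (z\<^sup>2 - \<rho>1\<^sup>2) * (z\<^sup>2 - \<rho>2\<^sup>2)"
proof -
  define s :: complex where "s = of_real (norm_sq (n - 1) \<xi>)"
  define a where "a = \<i> * complex_of_real \<tau>"
  define e where "e = csqrt (a\<^sup>2 - 4 * a)"
  define w1 where "w1 = (- a + e) / 2"
  define w2 where "w2 = (- a - e) / 2"
  have e2: "e\<^sup>2 = a\<^sup>2 - 4 * a" by (simp add: e_def)
  have "a\<^sup>2 - 4 * a \<noteq> 0"
    using assms by (auto simp: a_def complex_eq_iff power2_eq_square)
  then have "e \<noteq> 0" using e2 by auto
  then have w12: "w1 \<noteq> w2" by (simp add: w1_def w2_def)
  have fact: "a + w * (a + w) = (w - w1) * (w - w2)" for w :: complex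
  proof -
    have "4 * ((w - w1) * (w - w2)) = (2 * w + a)\<^sup>2 - e\<^sup>2"
      by (simp add: w1_def w2_def power2_eq_square field_simps)
    also have "\<dots> = (2 * w + a)\<^sup>2 - (a\<^sup>2 - 4 * a)"
      by (simp only: e2)
    also have "\<dots> = 4 * (a + w * (a + w))"
      by (simp add: power2_eq_square algebra_simps)
    finally have "4 * ((w - w1) * (w - w2)) = 4 * (a + w * (a + w))" .
    then show ?thesis by (metis mult_cancel_left zero_neq_numeral)
  qed
  have nonreal: "w \<noteq> of_real r" if "a + w * (a + w) = 0" for w :: complex and r :: real
  proof
    assume w: "w = of_real r"
    then have "Re (a + w * (a + w)) = r * r" "Im (a + w * (a + w)) = \<tau> + r * \<tau>"
      by (simp_all add: a_def)
    then show False using that assms by auto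
  qed
  have P: "poly (D_poly n \<tau> \<xi>) z = (z\<^sup>2 - (w1 - s)) * (z\<^sup>2 - (w2 - s))" for z :: complex
  proof -
    have "poly (D_poly n \<tau> \<xi>) z = a + (s + z\<^sup>2) * (a + (s + z\<^sup>2))"
      by (simp only: poly_D_poly s_def a_def)
    also have "\<dots> = (s + z\<^sup>2 - w1) * (s + z\<^sup>2 - w2)" by (rule fact)
    finally show ?thesis by (simp add: algebra_simps)
  qed
  have n1: "w1 - s \<noteq> of_real r" for r
    using nonreal[of w1 "norm_sq (n - 1) \<xi> + r"] fact[of w1] by (auto simp: s_def algebra_simps)
  have n2: "w2 - s \<noteq> of_real r" for r
    using nonreal[of w2 "norm_sq (n - 1) \<xi> + r"] fact[of w2] by (auto simp: s_def algebra_simps)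
  obtain \<rho>1 where r1: "Im \<rho>1 > 0" "\<rho>1\<^sup>2 = w1 - s"
    "\<And>z :: complex. z\<^sup>2 = w1 - s \<Longrightarrow> Im z > 0 \<Longrightarrow> z = \<rho>1"
    using upper_sqrt[of "w1 - s"] n1 by metis
  obtain \<rho>2 where r2: "Im \<rho>2 > 0" "\<rho>2\<^sup>2 = w2 - s"
    "\<And>z :: complex. z\<^sup>2 = w2 - s \<Longrightarrow> Im z > 0 \<Longrightarrow> z = \<rho>2"
    using upper_sqrt[of "w2 - s"] n2 by metis
  show ?thesis
  proof (rule that)
    show "\<rho>1 \<noteq> \<rho>2" using r1(2) r2(2) w12 by auto
    show "D_plus_roots n \<tau> \<xi> = {\<rho>1, \<rho>2}"
    proof (rule Set.set_eqI)
      fix z :: complex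
      have "z \<in> D_plus_roots n \<tau> \<xi> \<longleftrightarrow> (z\<^sup>2 = w1 - s \<or> z\<^sup>2 = w2 - s) \<and> Im z > 0"
        by (auto simp: D_plus_roots_def P)
      also have "\<dots> \<longleftrightarrow> z \<in> {\<rho>1, \<rho>2}"
        using r1 r2 by (metis insert_iff empty_iff)
      finally show "z \<in> D_plus_roots n \<tau> \<xi> \<longleftrightarrow> z \<in> {\<rho>1, \<rho>2}" .
    qed
    show "poly (D_poly n \<tau> \<xi>) z = (z\<^sup>2 - \<rho>1\<^sup>2) * (z\<^sup>2 - \<rho>2\<^sup>2)" for z :: complex
      by (simp only: P r1(2) r2(2))
  qed
qed

lemma D_plus_roots_two:
  assumes "\<tau> \<noteq> 0"
  shows "card (D_plus_roots n \<tau> \<xi>) = 2"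
  using D_plus_roots_aux[OF assms, of n \<xi>] by (metis card_2_iff)

lemma D_plus_eq:
  assumes "\<rho>1 \<noteq> \<rho>2" "D_plus_roots n \<tau> \<xi> = {\<rho>1, \<rho>2}"
  shows "D_plus n \<tau> \<xi> = [:- \<rho>1, 1:] * [:- \<rho>2, 1:]"
    and "d_plus n 2 \<tau> \<xi> = -1"
    and "d_plus n 1 \<tau> \<xi> = \<i> * (\<rho>1 + \<rho>2)"
    and "d_plus n 0 \<tau> \<xi> = \<rho>1 * \<rho>2"
proof -
  show eq: "D_plus n \<tau> \<xi> = [:- \<rho>1, 1:] * [:- \<rho>2, 1:]"
    using assms by (simp add: D_plus_def)
  show "d_plus n 2 \<tau> \<xi> = -1" "d_plus n 1 \<tau> \<xi> = \<i> * (\<rho>1 + \<rho>2)" "d_plus n 0 \<tau> \<xi> = \<rho>1 * \<rho>2"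
    by (simp_all add: d_plus_def eq numeral_2_eq_2 field_simps)
qed

lemma D_poly_eq_prod:
  assumes "\<tau> \<noteq> 0" "\<rho>1 \<noteq> \<rho>2" "D_plus_roots n \<tau> \<xi> = {\<rho>1, \<rho>2}"
  shows "D_poly n \<tau> \<xi> = [:- \<rho>1, 1:] * [:- \<rho>2, 1:] * [:\<rho>1, 1:] * [:\<rho>2, 1:]"
proof -
  obtain \<sigma>1 \<sigma>2 where s: "\<sigma>1 \<noteq> \<sigma>2" "D_plus_roots n \<tau> \<xi> = {\<sigma>1, \<sigma>2}"
    "\<And>z :: complex. poly (D_poly n \<tau> \<xi>) z = (z\<^sup>2 - \<sigma>1\<^sup>2) * (z\<^sup>2 - \<sigma>2\<^sup>2)"
    using D_plus_roots_aux[OF assms(1), of n \<xi>] by metis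
  have "\<sigma>1 = \<rho>1 \<and> \<sigma>2 = \<rho>2 \<or> \<sigma>1 = \<rho>2 \<and> \<sigma>2 = \<rho>1"
    using assms(3) s(2) by (simp add: doubleton_eq_iff)
  then have "poly (D_poly n \<tau> \<xi>) z = (z\<^sup>2 - \<rho>1\<^sup>2) * (z\<^sup>2 - \<rho>2\<^sup>2)" for z :: complex
    using s(3)[of z] by (metis mult.commute)
  then have "poly (D_poly n \<tau> \<xi>) = poly ([:- \<rho>1, 1:] * [:- \<rho>2, 1:] * [:\<rho>1, 1:] * [:\<rho>2, 1:])"
    by (simp add: fun_eq_iff power2_eq_square algebra_simps)
  then show ?thesis by (simp only: poly_eq_poly_eq_iff)
qed

lemma poly_D_plus:
  fixes z :: complex
  assumes "\<tau> \<noteq> 0"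
  shows "poly (D_plus n \<tau> \<xi>) z =
    d_plus n 2 \<tau> \<xi> * (\<i> * z)\<^sup>2 + d_plus n 1 \<tau> \<xi> * (\<i> * z) + d_plus n 0 \<tau> \<xi>"
proof -
  obtain \<rho>1 \<rho>2 where "\<rho>1 \<noteq> \<rho>2" "D_plus_roots n \<tau> \<xi> = {\<rho>1, \<rho>2}"
    using D_plus_roots_aux[OF assms, of n \<xi>] by metis
  note eqs = D_plus_eq[OF this]
  show ?thesis
    unfolding eqs by (simp add: power2_eq_square algebra_simps)
qed

end

theory Submission
  imports Defs
begin

text \<open>
  Fix a point \<open>(\<tau>, \<xi>')\<close> with \<open>\<tau> \<noteq> 0\<close>, so that \<open>D\<^sup>+\<close> has degree \<open>2\<close>. Read a row of the extended
  boundary matrix as the coefficients of a polynomial with respect to the powers of \<open>\<i> z\<close>. The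
  first two rows then are \<open>B\<^sub>1\<close> and \<open>B\<^sub>2\<close>, and the others are \<open>(\<i> z)\<^sup>l D\<^sup>+\<close> for \<open>l \<le> m + 1\<close>, which
  span the multiples of \<open>D\<^sup>+\<close> of degree at most \<open>m + 3\<close>. The determinant vanishes if and only if
  the rows are linearly dependent (\<open>det_coeff_rows_eq_0_iff\<close>), that is, if and only if
  \<open>c\<^sub>1 B\<^sub>1 + c\<^sub>2 B\<^sub>2 + Q D\<^sup>+ = 0\<close> for some \<open>c\<^sub>1\<close>, \<open>c\<^sub>2\<close> and some \<open>Q\<close> of degree at most \<open>m + 1\<close>, not all
  zero. Since \<open>D\<^sup>+ \<noteq> 0\<close>, this forces \<open>(c\<^sub>1, c\<^sub>2) \<noteq> 0\<close>. Conversely, if \<open>D\<^sup>+\<close> divides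
  \<open>c\<^sub>1 B\<^sub>1 + c\<^sub>2 B\<^sub>2\<close>, the quotient has degree at most \<open>1\<close>, as \<open>B\<^sub>1\<close> and \<open>B\<^sub>2\<close> have degree at most
  \<open>3\<close>; hence it is among the admissible \<open>Q\<close> whatever \<open>m\<close> is. So the determinant vanishes exactly
  where the Lopatinskii-Shapiro condition fails.
\<close>

text \<open>
  A matrix is singular when its rows have a nontrivial linear relation, and dividing column \<open>j\<close> by
  \<open>s\<^sup>j\<close> preserves such relations. The factor \<open>s\<close> serves to expand in powers of \<open>s z\<close>.
\<close>

lemma det_coeff_rows_eq_0_iff:
  fixes R :: "nat \<Rightarrow> 'a :: field poly"
  assumes deg: "\<And>i. i < N \<Longrightarrow> degree (R i) < N" and s: "s \<noteq> 0"
  shows "Determinant.det (Matrix.mat N N (\<lambda>(i, j). coeff (R i) j / s ^ j)) = 0 \<longleftrightarrow>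
    (\<exists>c. (\<exists>i<N. c i \<noteq> 0) \<and> (\<Sum>i<N. Polynomial.smult (c i) (R i)) = 0)"
    (is "Determinant.det ?A = 0 \<longleftrightarrow> _")
proof -
  let ?At = "transpose_mat ?A"
  have carr: "?At \<in> carrier_mat N N" by simp
  have "Determinant.det ?A = Determinant.det ?At"
    by (rule det_transpose[of _ N, symmetric]) simp
  then have 1: "Determinant.det ?A = 0 \<longleftrightarrow>
      (\<exists>v. v \<in> carrier_vec N \<and> v \<noteq> 0\<^sub>v N \<and> ?At *\<^sub>v v = 0\<^sub>v N)"
    using det_0_iff_vec_prod_zero_field[OF carr] by simp
  have entry: "vec_index (?At *\<^sub>v Matrix.vec N c) j = coeff (\<Sum>i<N. Polynomial.smult (c i) (R i)) j / s ^ j"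
    if "j < N" for c j
    using that
    by (simp add: scalar_prod_def coeff_sum sum_divide_distrib atLeast0LessThan mult.commute)
  have high: "coeff (\<Sum>i<N. Polynomial.smult (c i) (R i)) j = 0" if "j \<ge> N" for c j
  proof -
    have "coeff (R i) j = 0" if "i < N" for i
      using deg[OF that] \<open>j \<ge> N\<close> by (intro coeff_eq_0) linarith
    then show ?thesis by (simp add: coeff_sum)
  qed
  have 2: "?At *\<^sub>v Matrix.vec N c = 0\<^sub>v N \<longleftrightarrow> (\<Sum>i<N. Polynomial.smult (c i) (R i)) = 0" for c
  proof -
    have "?At *\<^sub>v Matrix.vec N c = 0\<^sub>v N \<longleftrightarrow>
        (\<forall>j<N. vec_index (?At *\<^sub>v Matrix.vec N c) j = 0)"
      by (auto simp: vec_eq_iff)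
    also have "\<dots> \<longleftrightarrow> (\<forall>j<N. coeff (\<Sum>i<N. Polynomial.smult (c i) (R i)) j = 0)"
      using s by (simp only: entry cong: imp_cong) simp
    also have "\<dots> \<longleftrightarrow> (\<Sum>i<N. Polynomial.smult (c i) (R i)) = 0"
      using high[of _ c] by (metis coeff_0 not_le poly_eqI)
    finally show ?thesis .
  qed
  have 3: "Matrix.vec N c \<noteq> 0\<^sub>v N \<longleftrightarrow> (\<exists>i<N. c i \<noteq> 0)" for c :: "nat \<Rightarrow> 'a"
    by (auto simp: vec_eq_iff)
  have "(\<exists>v. v \<in> carrier_vec N \<and> v \<noteq> 0\<^sub>v N \<and> ?At *\<^sub>v v = 0\<^sub>v N) \<longleftrightarrow>
      (\<exists>c. Matrix.vec N c \<noteq> 0\<^sub>v N \<and> ?At *\<^sub>v Matrix.vec N c = 0\<^sub>v N)"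
    (is "?ex_vec \<longleftrightarrow> ?ex_fun")
  proof
    assume ?ex_vec
    then obtain v where v: "v \<in> carrier_vec N" "v \<noteq> 0\<^sub>v N" "?At *\<^sub>v v = 0\<^sub>v N" by blast
    have "v = Matrix.vec N (vec_index v)" using v(1) by auto
    with v(2,3) show ?ex_fun by metis
  next
    assume ?ex_fun
    then show ?ex_vec using vec_carrier by blast
  qed
  then show ?thesis
    unfolding 1 2 3 by simp
qed

text \<open>
  The rows \<open>(s z)\<^sup>l d\<close> with \<open>l < k\<close> span the multiples \<open>g d\<close> with \<open>degree g < k\<close>, so a relation
  between all rows says that \<open>a p + b q\<close> is such a multiple. If \<open>a p + b q = g d\<close> for any \<open>g\<close>, the
  bounds on the degrees of \<open>p\<close> and \<open>q\<close> already force \<open>degree g < k\<close>. This is the divisibility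
  condition, and it is nontrivial in \<open>(a, b)\<close> because the shifts of \<open>d \<noteq> 0\<close> are independent.
\<close>

lemma det_shifted_rows_eq_0_iff:
  fixes p q d :: "'a :: field poly"
  assumes d: "degree d = 2" and p: "degree p < 2 + k" and q: "degree q < 2 + k" and s: "s \<noteq> 0"
  defines "R \<equiv> \<lambda>i. if i = 0 then p else if i = 1 then q else monom (s ^ (i - 2)) (i - 2) * d"
  shows "Determinant.det (Matrix.mat (2 + k) (2 + k) (\<lambda>(i, j). coeff (R i) j / s ^ j)) = 0 \<longleftrightarrow>
    (\<exists>a b. (a \<noteq> 0 \<or> b \<noteq> 0) \<and> d dvd Polynomial.smult a p + Polynomial.smult b q)"
proof -
  have d0: "d \<noteq> 0" using d by auto
  have deg: "degree (R i) < 2 + k" if "i < 2 + k" for i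
    using that p q s d0 d by (auto simp: R_def degree_mult_eq degree_monom_eq)
  define Q where "Q = (\<lambda>c :: nat \<Rightarrow> 'a. \<Sum>l<k. monom (c (2 + l) * s ^ l) l)"
  have sum: "(\<Sum>i<2 + k. Polynomial.smult (c i) (R i)) =
      Polynomial.smult (c 0) p + Polynomial.smult (c 1) q + Q c * d" for c
  proof -
    have "(\<Sum>i<2 + k. Polynomial.smult (c i) (R i)) =
        Polynomial.smult (c 0) (R 0) + Polynomial.smult (c 1) (R 1)
          + (\<Sum>l<k. Polynomial.smult (c (2 + l)) (R (2 + l)))"
      unfolding add_2_eq_Suc sum.lessThan_Suc_shift by (simp add: add.assoc)
    then show ?thesis
      by (simp add: R_def Q_def sum_distrib_right flip: smult_monom)
  qed
  have coeff_Q: "coeff (Q c) l = (if l < k then c (2 + l) * s ^ l else 0)" for c l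
    by (simp add: Q_def coeff_sum)
  have "(\<exists>c. (\<exists>i<2 + k. c i \<noteq> 0) \<and> (\<Sum>i<2 + k. Polynomial.smult (c i) (R i)) = 0) \<longleftrightarrow>
      (\<exists>a b. (a \<noteq> 0 \<or> b \<noteq> 0) \<and> d dvd Polynomial.smult a p + Polynomial.smult b q)"
    (is "?dep \<longleftrightarrow> ?div")
  proof
    assume ?dep
    then obtain c i where i: "i < 2 + k" "c i \<noteq> 0"
      and rel: "Polynomial.smult (c 0) p + Polynomial.smult (c 1) q + Q c * d = 0"
      unfolding sum by blast
    have "c 0 \<noteq> 0 \<or> c 1 \<noteq> 0"
    proof (rule ccontr)
      assume *: "\<not> (c 0 \<noteq> 0 \<or> c 1 \<noteq> 0)"
      then have "Q c = 0" using rel d0 by simp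
      moreover have "i \<noteq> 0" "i \<noteq> 1" using * i(2) by (metis, metis)
      then obtain l where "i = 2 + l" by (metis One_nat_def Suc_1 add_2_eq_Suc not0_implies_Suc)
      ultimately show False using coeff_Q[of c l] i s by simp
    qed
    moreover have "Polynomial.smult (c 0) p + Polynomial.smult (c 1) q = d * (- Q c)"
      using rel by (simp add: add_eq_0_iff2 mult.commute)
    ultimately show ?div by (metis dvd_triv_left)
  next
    assume ?div
    then obtain a b g where ab: "a \<noteq> 0 \<or> b \<noteq> 0"
      and g: "Polynomial.smult a p + Polynomial.smult b q = d * g" by blast
    have "degree (d * g) < 2 + k"
      using p q by (simp flip: g add: degree_add_less le_less_trans[OF degree_smult_le])
    then have "g = 0 \<or> degree g < k"
      using d d0 by (cases "g = 0") (auto simp: degree_mult_eq)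
    then have g_high: "coeff g l = 0" if "l \<ge> k" for l
      using that by (auto intro: coeff_eq_0)
    define c where "c = (\<lambda>i. if i = 0 then a else if i = 1 then b else - coeff g (i - 2) / s ^ (i - 2))"
    have "Q c = - g"
      using s g_high by (intro poly_eqI) (auto simp: coeff_Q c_def)
    then have "(\<Sum>i<2 + k. Polynomial.smult (c i) (R i)) = 0"
      unfolding sum using g by (simp add: c_def mult.commute)
    moreover have "\<exists>i<2 + k. c i \<noteq> 0"
      using ab by (intro exI[of _ "if a \<noteq> 0 then 0 else 1"]) (auto simp: c_def)
    ultimately show ?dep by blast
  qed
  with det_coeff_rows_eq_0_iff[of "2 + k" R, OF deg s] show ?thesis by simp
qed

lemma degree_D_plus:
  assumes "\<tau> \<noteq> 0"
  shows "degree (D_plus n \<tau> \<xi>) = 2"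
proof -
  obtain \<rho>1 \<rho>2 where "\<rho>1 \<noteq> \<rho>2" "D_plus_roots n \<tau> \<xi> = {\<rho>1, \<rho>2}"
    using D_plus_roots_aux[OF assms, of n \<xi>] by metis
  from D_plus_eq(1)[OF this] show ?thesis by simp
qed

lemma coeff_boundary_poly:
  "coeff (boundary_poly b \<tau> \<xi>) j = boundary_coeff b j \<tau> \<xi> * \<i> ^ j"
  by (simp add: boundary_poly_def boundary_coeff_def coeff_sum)

lemma degree_boundary_poly: "degree (boundary_poly b \<tau> \<xi>) \<le> 3"
  by (rule degree_le) (simp add: coeff_boundary_poly boundary_coeff_def)

lemma d_plus_eq_coeff:
  assumes "\<tau> \<noteq> 0"
  shows "d_plus n (int k) \<tau> \<xi> = coeff (D_plus n \<tau> \<xi>) k / \<i> ^ k"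
  using degree_D_plus[OF assms, of n \<xi>] by (auto simp: d_plus_def coeff_eq_0)

text \<open>
  Since \<open>b\<^sub>j\<close> and \<open>d\<^sub>j\<^sup>+\<close> are coefficients in powers of \<open>\<i> z\<close>, this is the matrix of
  \<open>det_shifted_rows_eq_0_iff\<close> for \<open>s = \<i>\<close> and \<open>k = m + 2\<close>. The factor \<open>\<i>\<^sup>l\<close> of the shifted row
  \<open>(\<i> z)\<^sup>l D\<^sup>+\<close> compensates for the shift of the column index in \<open>\<i>\<^sup>j\<close>.
\<close>

lemma extended_boundary_matrix_eq:
  assumes "\<tau> \<noteq> 0"
  shows "extended_boundary_matrix n m b1 b2 \<tau> \<xi> =
    Matrix.mat (2 + (2 + m)) (2 + (2 + m)) (\<lambda>(i, j). coeff
      (if i = 0 then boundary_poly b1 \<tau> \<xi> else if i = 1 then boundary_poly b2 \<tau> \<xi>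
       else monom (\<i> ^ (i - 2)) (i - 2) * D_plus n \<tau> \<xi>) j / \<i> ^ j)"
proof -
  have shift: "d_plus n (int j + 2 - int i) \<tau> \<xi> =
      coeff (monom (\<i> ^ (i - 2)) (i - 2) * D_plus n \<tau> \<xi>) j / \<i> ^ j" if "i \<ge> 2" for i j
  proof (cases "j \<ge> i - 2")
    case True
    have "int j + 2 - int i = int (j - (i - 2))" using that True by simp
    then have "d_plus n (int j + 2 - int i) \<tau> \<xi> =
        coeff (D_plus n \<tau> \<xi>) (j - (i - 2)) / \<i> ^ (j - (i - 2))"
      by (simp only: d_plus_eq_coeff[OF assms])
    moreover have "\<i> ^ j = \<i> ^ (i - 2) * \<i> ^ (j - (i - 2))"
      using True by (simp flip: power_add)
    ultimately show ?thesis using True by (simp add: coeff_monom_mult)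
  next
    case False
    then have "int j + 2 - int i < 0" using that by linarith
    then show ?thesis using False by (simp add: coeff_monom_mult d_plus_def)
  qed
  have "extended_boundary_entry n b1 b2 (i + 1) (j + 1) \<tau> \<xi> = coeff
      (if i = 0 then boundary_poly b1 \<tau> \<xi> else if i = 1 then boundary_poly b2 \<tau> \<xi>
       else monom (\<i> ^ (i - 2)) (i - 2) * D_plus n \<tau> \<xi>) j / \<i> ^ j" for i j
  proof (cases "i \<ge> 2")
    case True
    have "extended_boundary_entry n b1 b2 (i + 1) (j + 1) \<tau> \<xi> = d_plus n (int j + 2 - int i) \<tau> \<xi>"
      using True by (simp add: extended_boundary_entry_def algebra_simps)
    then show ?thesis using shift[OF True, of j] True by simp
  next
    case False
    then have "i = 0 \<or> i = 1" by linarith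
    then show ?thesis by (auto simp: extended_boundary_entry_def coeff_boundary_poly)
  qed
  moreover have "4 + m = 2 + (2 + m)" by simp
  ultimately show ?thesis
    unfolding extended_boundary_matrix_def by (simp only:)
qed

theorem proposition5p1:
  fixes n m :: nat and b1 b2 :: boundary_operator
  assumes "n \<ge> 1"
    and "smooth_boundary_operator n b1" and "smooth_boundary_operator n b2"
  shows "lopatinskii_shapiro n b1 b2 \<longleftrightarrow>
    (\<forall>(\<tau>, \<xi>) \<in> symbol_domain n.
       Determinant.det (extended_boundary_matrix n m b1 b2 \<tau> \<xi>) \<noteq> 0)"
proof -
  have "Determinant.det (extended_boundary_matrix n m b1 b2 \<tau> \<xi>) = 0 \<longleftrightarrow>
      (\<exists>c1 c2. (c1 \<noteq> 0 \<or> c2 \<noteq> 0) \<and> D_plus n \<tau> \<xi> dvd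
        Polynomial.smult c1 (boundary_poly b1 \<tau> \<xi>) + Polynomial.smult c2 (boundary_poly b2 \<tau> \<xi>))"
    if "(\<tau>, \<xi>) \<in> symbol_domain n" for \<tau> \<xi>
  proof -
    have \<tau>: "\<tau> \<noteq> 0" using that by (simp add: symbol_domain_def)
    have deg: "degree (boundary_poly b \<tau> \<xi>) < 2 + (2 + m)" for b
      using degree_boundary_poly[of b \<tau> \<xi>] by linarith
    show ?thesis
      unfolding extended_boundary_matrix_eq[OF \<tau>]
      by (rule det_shifted_rows_eq_0_iff[OF degree_D_plus[OF \<tau>] deg deg]) simp
  qed
  then show ?thesis
    unfolding lopatinskii_shapiro_def by blast
qed

end
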